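(* Let $m\ge1$ and let $\mathbf u=(u_1,\dots,u_m)$ be a vector of positive integers with $u_1<\cdots<u_m$. Then $$|\mathrm{PF}(\mathbf u)|=\sum_{\mathbf s\in C(m)}\binom{m}{\mathbf s}\prod_{i=1}^{u_m-m+1}(s_i+1)^{s_i-1},$$ where $C(m)$ is the set of vectors $\mathbf s=(s_1,\dots,s_{u_m-m+1})$ of non-negative integers with $\sum_{i=1}^{u_m-m+1}s_i=m$ and $s_1+\cdots+s_{u_i-i+1}\ge i$ for all $1\le i\le m$.
   Context: A $\mathbf u$-parking function of length $m$ is a sequence $(\pi_1,\dots,\pi_m)$ of positive integers whose non-decreasing rearrangement $(\lambda_1,\dots,\lambda_m)$ satisfies $\lambda_i\le u_i$ for all $1\le i\le m$; the set of these is $\mathrm{PF}(\mathbf u)$. $\binom{m}{\mathbf s}=\frac{m!}{\prod_i s_i!}$ is the multinomial coefficient. *)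

theory Defs
  imports Complex_Main
begin

(* Vectors are lists, so indices are shifted by one: the i-th entry u_i (i >= 1) is u ! (i - 1). *)

definition PF :: "nat list \<Rightarrow> nat list set" where
  "PF u = {p. length p = length u \<and> (\<forall>x\<in>set p. x \<ge> 1) \<and>
     (\<forall>i\<in>{1..length u}. sort p ! (i - 1) \<le> u ! (i - 1))}"

definition multinomial :: "nat \<Rightarrow> nat list \<Rightarrow> real" where
  "multinomial m s = fact m / (\<Prod>i=1..length s. fact (s ! (i - 1)))"

(* The subtractions u_m - m and u_i - i are on nat. They do not truncate when the entries of u
   are positive and strictly increasing, and then u_i - i + 1 is at most the length of s. *)
definition C :: "nat list \<Rightarrow> nat list set" where
  "C u = (let m = length u in
     {s. length s = u ! (m - 1) - m + 1 \<and>
         (\<Sum>i=1..u ! (m - 1) - m + 1. s ! (i - 1)) = m \<and>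
         (\<forall>i\<in>{1..m}. (\<Sum>j=1..u ! (i - 1) - i + 1. s ! (j - 1)) \<ge> i)})"

end

theory Submission
  imports Defs "HOL-Library.FuncSet"
begin

text \<open>
  Read \<open>\<pi>\<close> as the preferences of \<open>m\<close> cars entering a one-way street with \<open>u\<^sub>m\<close> spots, where a car
  takes the first free spot at or after its preferred one. As \<open>u\<close> is strictly increasing, all cars
  of a \<open>u\<close>-parking function find a spot, and the \<open>u\<^sub>m - m\<close> spots left empty cut the street into
  \<open>u\<^sub>m - m + 1\<close> blocks, the \<open>i\<close>-th with \<open>s\<^sub>i\<close> cars. Within one block the preferences, counted
  from the start of the block, form a classical parking function, and there are
  \<open>(s\<^sub>i + 1) ^ (s\<^sub>i - 1)\<close> of these; the multinomial coefficient counts the ways to distribute the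
  cars over the blocks. The inequalities defining \<open>C(m)\<close> say that among the first \<open>u\<^sub>i\<close> spots at
  least \<open>i\<close> are occupied, which characterises the outcomes of \<open>u\<close>-parking functions.

  The formal argument never simulates the parking. It only locates the first empty spot: the
  smallest \<open>e\<close> such that fewer than \<open>e\<close> cars prefer a spot up to \<open>e\<close>. Cutting there
  (\<open>bij_betw_cut\<close>) gives a bijection between parking maps and triples of the set of
  cars in the first block, a classical parking map on that set, and a parking map of the other cars
  for a shifted vector. The resulting recursion is used twice.

  \<^item> For a constant vector the left-hand side is a plain power, and the recursion is the special
    case \<open>Abel_identity_special\<close> of Abel's binomial theorem with the unknown number of classical
    parking maps in place of \<open>(k + 1) ^ (k - 1)\<close>. As it determines that number, the classical count
    \<open>card_classical_parking_maps\<close> follows.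

  \<^item> For a strictly increasing vector, induction on the number of blocks yields the sum over all
    block sizes (\<open>card_parking_maps_eq_gap_sum\<close>), because splitting off the first block
    matches deleting the first entry of \<open>s\<close> (\<open>gap_vectors_Suc\<close>).
\<close>

section \<open>A special case of Abel's binomial theorem\<close>

text \<open>The \<open>n\<close>-th finite difference of a polynomial of degree less than \<open>n\<close> vanishes. Splitting one
factor \<open>a + k\<close> off the power and absorbing \<open>k\<close> into the binomial coefficient lowers the degree.\<close>

lemma alternating_binomial_sum_power_eq_0:
  fixes a :: real
  assumes "d < n"
  shows "(\<Sum>k\<le>n. (-1) ^ k * real (n choose k) * (a + real k) ^ d) = 0"
  using assms
proof (induction d arbitrary: n a)
  case 0
  then show ?case using choose_alternating_sum[of n, where 'a = real] by simp
next
  case (Suc d)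
  obtain l where n: "n = Suc l" using Suc.prems by (cases n) auto
  have absorb: "(-1) ^ Suc k * (real (n choose Suc k) * real (Suc k)) * (a + real (Suc k)) ^ d
      = - real n * ((-1) ^ k * real (l choose k) * ((a + 1) + real k) ^ d)" for k
  proof -
    have "real (n choose Suc k) * real (Suc k) = real n * real (l choose k)"
      unfolding n of_nat_mult[symmetric] by (subst Suc_times_binomial[symmetric]) (simp only: mult.commute)
    then show ?thesis by (simp add: add_ac)
  qed
  have "(\<Sum>k\<le>n. (-1) ^ k * real (n choose k) * (a + real k) ^ Suc d)
      = a * (\<Sum>k\<le>n. (-1) ^ k * real (n choose k) * (a + real k) ^ d)
        + (\<Sum>k\<le>n. (-1) ^ k * (real (n choose k) * real k) * (a + real k) ^ d)"
    by (simp add: sum_distrib_left sum.distrib[symmetric] algebra_simps)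
  also have "(\<Sum>k\<le>n. (-1) ^ k * (real (n choose k) * real k) * (a + real k) ^ d)
      = - real n * (\<Sum>k\<le>l. (-1) ^ k * real (l choose k) * ((a + 1) + real k) ^ d)"
    unfolding sum_distrib_left absorb[symmetric] unfolding n by (subst sum.atMost_Suc_shift) simp
  finally show ?case
    using Suc.IH[of n a] Suc.IH[of l "a + 1"] Suc.prems n by simp
qed

text \<open>Both sides are polynomials in \<open>x\<close> whose derivatives are \<open>m\<close> times the identity for \<open>m - 1\<close>.
It remains to compare them at \<open>x = 0\<close>, where the factors \<open>(k + 1) ^ (k - 1)\<close> and
\<open>(- k - 1) ^ (m - k)\<close> combine, up to sign, to a power of fixed exponent \<open>m - 1\<close>, so that the
right-hand side is a vanishing finite difference.\<close>

lemma Abel_identity_special: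
  fixes x :: real
  shows "x ^ m = (\<Sum>k\<le>m. real (m choose k) * (real k + 1) ^ (k - 1) * (x - real k - 1) ^ (m - k))"
proof (induction m arbitrary: x)
  case 0
  then show ?case by simp
next
  case (Suc m)
  define R where "R y = (\<Sum>k\<le>Suc m. real (Suc m choose k) * (real k + 1) ^ (k - 1) * (y - real k - 1) ^ (Suc m - k))"
    for y :: real
  have absorb: "real (Suc m choose k) * real (Suc m - k) = real (Suc m) * real (m choose k)" if "k \<le> m" for k
    using binomial_absorb_comp[of "Suc m" k] by (metis diff_Suc_1 mult.commute of_nat_mult)
  have "((\<lambda>y. y ^ Suc m - R y) has_real_derivative 0) (at y)" for y
  proof -
    have "(R has_real_derivative
        (\<Sum>k\<le>Suc m. real (Suc m choose k) * (real k + 1) ^ (k - 1) *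
           (real (Suc m - k) * (y - real k - 1) ^ (Suc m - k - 1)))) (at y)"
      unfolding R_def by (rule DERIV_sum) (auto intro!: derivative_eq_intros)
    also have "(\<Sum>k\<le>Suc m. real (Suc m choose k) * (real k + 1) ^ (k - 1) *
           (real (Suc m - k) * (y - real k - 1) ^ (Suc m - k - 1)))
       = real (Suc m) * (\<Sum>k\<le>m. real (m choose k) * (real k + 1) ^ (k - 1) * (y - real k - 1) ^ (m - k))"
    proof -
      have "real (Suc m choose k) * (real k + 1) ^ (k - 1) *
             (real (Suc m - k) * (y - real k - 1) ^ (Suc m - k - 1))
          = real (Suc m) * (real (m choose k) * (real k + 1) ^ (k - 1) * (y - real k - 1) ^ (m - k))"
        if "k \<le> m" for k
      proof -
        have "real (Suc m choose k) * (real k + 1) ^ (k - 1) *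
             (real (Suc m - k) * (y - real k - 1) ^ (Suc m - k - 1))
          = (real (Suc m choose k) * real (Suc m - k)) * ((real k + 1) ^ (k - 1) *
             (y - real k - 1) ^ (m - k))"
          by simp
        then show ?thesis unfolding absorb[OF that] by (simp only: mult.assoc)
      qed
      then have "(\<Sum>k\<le>m. real (Suc m choose k) * (real k + 1) ^ (k - 1) *
             (real (Suc m - k) * (y - real k - 1) ^ (Suc m - k - 1)))
          = (\<Sum>k\<le>m. real (Suc m) * (real (m choose k) * (real k + 1) ^ (k - 1) * (y - real k - 1) ^ (m - k)))"
        by (intro sum.cong) auto
      then show ?thesis unfolding sum_distrib_left sum.atMost_Suc by (simp only:) simp
    qed
    also have "\<dots> = real (Suc m) * y ^ m" using Suc.IH by simp
    finally have "(R has_real_derivative real (Suc m) * y ^ m) (at y)" .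
    then have "((\<lambda>y. y ^ Suc m - R y) has_real_derivative
        real (Suc m) * y ^ m - real (Suc m) * y ^ m) (at y)"
      using DERIV_pow[of "Suc m" y UNIV] by (intro DERIV_diff) (simp_all del: of_nat_Suc power_Suc)
    then show ?thesis by simp
  qed
  then have "x ^ Suc m - R x = 0 ^ Suc m - R 0"
    by (intro DERIV_isconst_all) blast
  moreover have "R 0 = 0"
  proof -
    have "R 0 = (\<Sum>k\<le>Suc m. (-1) ^ Suc m * ((-1) ^ k * real (Suc m choose k) * (1 + real k) ^ m))"
      unfolding R_def
    proof (rule sum.cong[OF refl])
      fix k assume "k \<in> {..Suc m}"
      then have k: "k \<le> Suc m" by simp
      have "(real k + 1) ^ (k - 1) * (0 - real k - 1) ^ (Suc m - k)
          = (-1) ^ (Suc m - k) * ((1 + real k) ^ (k - 1) * (1 + real k) ^ (Suc m - k))"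
      proof -
        have "0 - real k - 1 = - (1 + real k)" by simp
        then show ?thesis
          using power_minus[of "1 + real k" "Suc m - k"] by (simp only: mult_ac add.commute[of 1])
      qed
      also have "(1 + real k) ^ (k - 1) * (1 + real k) ^ (Suc m - k) = (1 + real k) ^ m"
        using k by (cases k) (auto simp: power_add[symmetric])
      also have "(-1) ^ (Suc m - k) = ((-1) ^ Suc m * (-1) ^ k :: real)"
        using k by (metis minus_one_power_iff power_add[symmetric] even_add even_diff_nat not_le)
      finally show "real (Suc m choose k) * (real k + 1) ^ (k - 1) * (0 - real k - 1) ^ (Suc m - k)
          = (-1) ^ Suc m * ((-1) ^ k * real (Suc m choose k) * (1 + real k) ^ m)"
        by (simp add: mult_ac)
    qed
    also have "\<dots> = 0"
      unfolding sum_distrib_left[symmetric]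
      using alternating_binomial_sum_power_eq_0[of m "Suc m" 1] by simp
    finally show ?thesis .
  qed
  ultimately show ?case unfolding R_def by simp
qed

section \<open>Parking maps\<close>

text \<open>The \<open>u\<close>-parking functions with an arbitrary set \<open>A\<close> of cars as index set, since the recursion
passes to subsets of the cars. The \<open>i\<close>-th smallest preference is at most \<open>u i\<close> iff at least \<open>i\<close>
cars have a preference of at most \<open>u i\<close>; this form needs no sorting. Indices of \<open>u\<close> start at \<open>1\<close>,
and \<open>parking_maps A id\<close> consists of the classical parking functions.\<close>

definition parking_maps :: "'a set \<Rightarrow> (nat \<Rightarrow> nat) \<Rightarrow> ('a \<Rightarrow> nat) set" where
  "parking_maps A u = {f \<in> A \<rightarrow>\<^sub>E {1..}. \<forall>i\<in>{1..card A}. i \<le> card {j\<in>A. f j \<le> u i}}"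

text \<open>The condition for the last index \<open>i = card A\<close> already forces every preference to be
at most \<open>u (card A)\<close>.\<close>

lemma parking_map_le:
  assumes "finite A" "f \<in> parking_maps A u" "j \<in> A"
  shows "f j \<le> u (card A)"
proof -
  have "card A \<in> {1..card A}" using assms by (auto simp: Suc_le_eq card_gt_0_iff)
  then have "card A \<le> card {j\<in>A. f j \<le> u (card A)}"
    using assms(2) unfolding parking_maps_def by blast
  then have "{j\<in>A. f j \<le> u (card A)} = A"
    using assms(1) by (intro card_seteq) auto
  then show ?thesis using assms(3) by blast
qed

lemma finite_parking_maps:
  assumes "finite A"
  shows "finite (parking_maps A u)"
proof (rule finite_subset)
  show "parking_maps A u \<subseteq> A \<rightarrow>\<^sub>E {..u (card A)}"
  proof
    fix f assume f: "f \<in> parking_maps A u"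
    then have "f \<in> extensional A" by (simp add: parking_maps_def PiE_iff)
    then show "f \<in> A \<rightarrow>\<^sub>E {..u (card A)}"
      using parking_map_le[OF assms f] by (simp add: PiE_iff)
  qed
qed (use assms in \<open>auto intro: finite_PiE\<close>)

lemma parking_maps_empty:
  fixes A :: "'a set"
  assumes "1 \<le> card A" and "u 1 = 0"
  shows "parking_maps A u = {}"
proof -
  have "f \<notin> parking_maps A u" for f
  proof
    assume f: "f \<in> parking_maps A u"
    then have "{j\<in>A. f j \<le> u 1} = {}" using assms(2) by (force simp: parking_maps_def PiE_iff)
    moreover have "1 \<le> card {j\<in>A. f j \<le> u 1}" using f assms(1) unfolding parking_maps_def by simp
    ultimately have "1 \<le> card ({} :: 'a set)" by (simp only:)
    then show False by simp
  qed
  then show ?thesis by blast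
qed

text \<open>For a constant vector, the conditions just bound all preferences.\<close>

lemma card_parking_maps_const:
  assumes A: "finite A"
  shows "card (parking_maps A (\<lambda>_. x)) = x ^ card A"
proof -
  have "parking_maps A (\<lambda>_. x) = A \<rightarrow>\<^sub>E {1..x}"
  proof (intro equalityI subsetI)
    fix f assume f: "f \<in> parking_maps A (\<lambda>_. x)"
    show "f \<in> A \<rightarrow>\<^sub>E {1..x}"
      using f parking_map_le[OF A f] unfolding parking_maps_def by (auto simp: PiE_iff)
  next
    fix f assume f: "f \<in> A \<rightarrow>\<^sub>E {1..x}"
    then have "{j\<in>A. f j \<le> x} = A" by (auto simp: PiE_iff)
    then show "f \<in> parking_maps A (\<lambda>_. x)" using f by (auto simp: parking_maps_def PiE_iff)
  qed
  then show ?thesis using A by (simp add: card_PiE)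
qed

section \<open>Cutting at the first empty spot\<close>

text \<open>The bounds seen by the cars that come after a first block of \<open>k\<close> cars: those cars and
the empty spot behind them are removed, so indices drop by \<open>k\<close> and positions by \<open>k + 1\<close>.\<close>

definition shift :: "nat \<Rightarrow> (nat \<Rightarrow> nat) \<Rightarrow> nat \<Rightarrow> nat" where
  "shift k u i = u (i + k) - Suc k"

text \<open>The spots \<open>1, \<dots>, s\<close> are occupied and \<open>s + 1\<close> is empty, when all cars have parked, for
the smallest \<open>s\<close> such that at most \<open>s\<close> cars prefer a spot up to \<open>s + 1\<close>.\<close>

definition cars_before_gap :: "'a set \<Rightarrow> ('a \<Rightarrow> nat) \<Rightarrow> nat" where
  "cars_before_gap A f = (LEAST s. card {j\<in>A. f j \<le> Suc s} \<le> s)"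

lemma le_card_before_gap:
  assumes "i \<le> cars_before_gap A f"
  shows "i \<le> card {j\<in>A. f j \<le> i}"
proof (cases i)
  case (Suc t)
  then have "t < cars_before_gap A f" using assms by simp
  then have "\<not> card {j\<in>A. f j \<le> Suc t} \<le> t"
    unfolding cars_before_gap_def by (rule not_less_Least)
  then show ?thesis using Suc by simp
qed simp

text \<open>At least \<open>s\<close> preferences lie in the first \<open>s\<close> spots, by minimality of \<open>s\<close>, and
at most \<open>s\<close> in the first \<open>s + 1\<close>; so nobody prefers the empty spot. Minimizing is meaningful
because \<open>s = card A\<close> always qualifies.\<close>

lemma card_first_block:
  fixes f :: "'a \<Rightarrow> nat"
  assumes "finite A"
  defines "s \<equiv> cars_before_gap A f"
  shows "card {j\<in>A. f j \<le> Suc s} = s"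
proof (rule antisym)
  have "card {j\<in>A. f j \<le> Suc (card A)} \<le> card A"
    using assms by (intro card_mono) auto
  then show "card {j\<in>A. f j \<le> Suc s} \<le> s"
    unfolding s_def cars_before_gap_def by (rule LeastI)
  have "s \<le> card {j\<in>A. f j \<le> s}"
    unfolding s_def by (rule le_card_before_gap) simp
  also have "\<dots> \<le> card {j\<in>A. f j \<le> Suc s}"
    using assms by (intro card_mono) auto
  finally show "s \<le> card {j\<in>A. f j \<le> Suc s}" .
qed

text \<open>The two directions of the correspondence between a map and its first block \<open>S\<close>, the map on
\<open>S\<close>, and the map on the remaining cars with positions counted from behind the gap.\<close>

definition glue :: "'a set \<Rightarrow> 'a set \<times> ('a \<Rightarrow> nat) \<times> ('a \<Rightarrow> nat) \<Rightarrow> 'a \<Rightarrow> nat" where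
  "glue A = (\<lambda>(S, g, h) j. if j \<in> S then g j else if j \<in> A then h j + Suc (card S) else undefined)"

definition cut :: "'a set \<Rightarrow> ('a \<Rightarrow> nat) \<Rightarrow> 'a set \<times> ('a \<Rightarrow> nat) \<times> ('a \<Rightarrow> nat)" where
  "cut A f = (let s = cars_before_gap A f; S = {j\<in>A. f j \<le> Suc s} in
     (S, restrict f S, \<lambda>j\<in>A - S. f j - Suc s))"

text \<open>The cars of the first block park classically among themselves, by minimality of the gap. Let
\<open>s\<close> be their number. They all satisfy the bound \<open>u i\<close> for \<open>i > s\<close>, as
\<open>u i \<ge> i > s\<close>, so the \<open>i\<close>-th condition on the whole map is the \<open>(i - s)\<close>-th condition on
the remaining cars. For \<open>i \<le> s\<close> the condition follows from \<open>u i \<ge> i\<close> and the classical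
one. Conversely, gluing any such data puts the first empty spot at \<open>s + 1\<close> again. The case
\<open>u i = s + 1\<close> for \<open>i = s + 1\<close> fits in: the shifted bound is then \<open>0\<close>, and neither side has an
element with this first block.\<close>

lemma bij_betw_cut:
  assumes A: "finite A" and u: "\<And>i. i \<in> {1..card A} \<Longrightarrow> i \<le> u i"
  shows "bij_betw (cut A) (parking_maps A u)
    (SIGMA S:Pow A. parking_maps S id \<times> parking_maps (A - S) (shift (card S) u))"
    (is "bij_betw _ ?M ?T")
proof (rule bij_betw_byWitness[where f' = "glue A"])
  show "\<forall>f\<in>?M. glue A (cut A f) = f"
  proof
    fix f assume "f \<in> ?M"
    then have f: "f \<in> extensional A" unfolding parking_maps_def by (auto simp: PiE_iff)
    show "glue A (cut A f) = f"
      using f card_first_block[OF A, of f]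
      by (auto simp: fun_eq_iff glue_def cut_def Let_def extensional_def)
  qed
next
  show "\<forall>t\<in>?T. cut A (glue A t) = t"
  proof
    fix t assume "t \<in> ?T"
    then obtain S g h where t: "t = (S, g, h)" and S: "S \<subseteq> A" and g: "g \<in> parking_maps S id"
      and h: "h \<in> parking_maps (A - S) (shift (card S) u)"
      by auto
    define f where "f = glue A (S, g, h)"
    have finS: "finite S" using S A finite_subset by blast
    have fS: "f j = g j" if "j \<in> S" for j using that by (simp add: f_def glue_def)
    have fAS: "f j = h j + Suc (card S)" "h j \<ge> 1" if "j \<in> A - S" for j
      using that h by (auto simp: f_def glue_def parking_maps_def PiE_iff)
    have g_le: "g j \<le> card S" if "j \<in> S" for j
      using parking_map_le[OF finS g that] by simp
    have Seq: "{j\<in>A. f j \<le> Suc (card S)} = S"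
      using g_le S fS fAS by (fastforce simp: not_le)
    have gap: "cars_before_gap A f = card S"
      unfolding cars_before_gap_def
    proof (rule Least_equality)
      show "card {j\<in>A. f j \<le> Suc (card S)} \<le> card S" using Seq by simp
    next
      fix s assume s: "card {j\<in>A. f j \<le> Suc s} \<le> s"
      show "card S \<le> s"
      proof (rule ccontr)
        assume "\<not> card S \<le> s"
        then have "Suc s \<le> card {j\<in>S. g j \<le> Suc s}"
          using g unfolding parking_maps_def by auto
        also have "\<dots> \<le> card {j\<in>A. f j \<le> Suc s}"
          using S fS A by (intro card_mono) auto
        finally show False using s by simp
      qed
    qed
    have "restrict f S = g"
      using g fS by (auto simp: fun_eq_iff parking_maps_def PiE_iff extensional_def)
    moreover have "(\<lambda>j\<in>A - S. f j - Suc (card S)) = h"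
      using h fAS by (auto simp: fun_eq_iff parking_maps_def PiE_iff extensional_def)
    ultimately show "cut A (glue A t) = t"
      unfolding t f_def[symmetric] cut_def Let_def gap Seq by simp
  qed
next
  show "cut A ` ?M \<subseteq> ?T"
  proof (rule image_subsetI)
    fix f assume f: "f \<in> ?M"
    obtain S g h where eq: "cut A f = (S, g, h)" by (cases "cut A f")
    define s where "s = cars_before_gap A f"
    have S: "S = {j\<in>A. f j \<le> Suc s}" and g: "g = restrict f S"
      and h: "h = (\<lambda>j\<in>A - S. f j - Suc s)"
      using eq by (auto simp: cut_def Let_def s_def)
    have cS: "card S = s" using card_first_block[OF A, of f] S s_def by simp
    have SA: "S \<subseteq> A" using S by auto
    have finS: "finite S" using SA A finite_subset by blast
    have "g \<in> parking_maps S id"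
      unfolding parking_maps_def
    proof (intro CollectI conjI ballI)
      show "g \<in> S \<rightarrow>\<^sub>E {1..}" using f SA g unfolding parking_maps_def by (auto simp: PiE_iff)
    next
      fix i assume i: "i \<in> {1..card S}"
      then have "i \<le> card {j\<in>A. f j \<le> i}"
        using le_card_before_gap[of i A f] cS s_def by simp
      also have "{j\<in>A. f j \<le> i} = {j\<in>S. g j \<le> id i}"
        using i cS unfolding g S by auto
      finally show "i \<le> card {j\<in>S. g j \<le> id i}" .
    qed
    moreover have "h \<in> parking_maps (A - S) (shift (card S) u)"
      unfolding parking_maps_def
    proof (intro CollectI conjI ballI)
      show "h \<in> A - S \<rightarrow>\<^sub>E {1..}" unfolding h S by (auto simp: PiE_iff)
    next
      fix i assume i: "i \<in> {1..card (A - S)}"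
      have cA: "card A = card (A - S) + card S"
        using card_Diff_subset[OF finS SA] card_mono[OF A SA] by simp
      then have i': "i + s \<in> {1..card A}" using i cS by auto
      have "i + s \<le> card {j\<in>A. f j \<le> u (i + s)}"
        using f i' unfolding parking_maps_def by blast
      also have "\<dots> \<le> card (S \<union> {j\<in>A - S. h j \<le> shift (card S) u i})"
        using A finS cS by (intro card_mono) (auto simp: h shift_def)
      also have "\<dots> \<le> s + card {j\<in>A - S. h j \<le> shift (card S) u i}"
        using card_Un_le cS by metis
      finally show "i \<le> card {j\<in>A - S. h j \<le> shift (card S) u i}" by simp
    qed
    ultimately show "cut A f \<in> ?T" using SA eq by auto
  qed
next
  show "glue A ` ?T \<subseteq> ?M"
  proof clarify
    fix S g h
    assume S: "S \<subseteq> A" and g: "g \<in> parking_maps S id"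
      and h: "h \<in> parking_maps (A - S) (shift (card S) u)"
    define f where "f = glue A (S, g, h)"
    have finS: "finite S" using S A finite_subset by blast
    have fS: "f j = g j" if "j \<in> S" for j using that by (simp add: f_def glue_def)
    have fAS: "f j = h j + Suc (card S)" "h j \<ge> 1" if "j \<in> A - S" for j
      using that h by (auto simp: f_def glue_def parking_maps_def PiE_iff)
    have g1: "g j \<ge> 1" if "j \<in> S" for j using that g by (auto simp: parking_maps_def PiE_iff)
    have cA: "card A = card (A - S) + card S"
      using card_Diff_subset[OF finS S] card_mono[OF A S] by simp
    have "f \<in> parking_maps A u"
      unfolding parking_maps_def
    proof (intro CollectI conjI ballI)
      have "f j \<ge> 1" if "j \<in> A" for j
        using that fS fAS g1 by (cases "j \<in> S") auto
      then show "f \<in> A \<rightarrow>\<^sub>E {1..}"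
        using S by (auto simp: PiE_iff extensional_def f_def glue_def)
    next
      fix i assume i: "i \<in> {1..card A}"
      show "i \<le> card {j\<in>A. f j \<le> u i}"
      proof (cases "i \<le> card S")
        case True
        then have "i \<le> card {j\<in>S. g j \<le> i}" using g i unfolding parking_maps_def by auto
        also have "\<dots> \<le> card {j\<in>A. f j \<le> u i}"
          using u[OF i] S fS A by (intro card_mono) auto
        finally show ?thesis .
      next
        case False
        define l where "l = i - card S"
        have l: "i = l + card S" "l \<in> {1..card (A - S)}" using False i cA by (auto simp: l_def)
        have "l \<le> card {j\<in>A - S. h j \<le> shift (card S) u l}"
          using h l unfolding parking_maps_def by blast
        then have "i \<le> card S + card {j\<in>A - S. h j \<le> shift (card S) u l}" using l by simp
        also have "\<dots> = card (S \<union> {j\<in>A - S. h j \<le> shift (card S) u l})"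
          using finS A by (intro card_Un_disjoint[symmetric]) auto
        also have "\<dots> \<le> card {j\<in>A. f j \<le> u i}"
        proof (intro card_mono subsetI)
          fix j assume "j \<in> S \<union> {j\<in>A - S. h j \<le> shift (card S) u l}"
          moreover have "f j \<le> u i" if "j \<in> S"
            using parking_map_le[OF finS g that] fS[OF that] u[OF i] False by simp
          moreover have "f j \<le> u i" if "j \<in> A - S" "h j \<le> shift (card S) u l"
            using that fAS[OF that(1)] l by (simp add: shift_def)
          ultimately show "j \<in> {j\<in>A. f j \<le> u i}" using S by auto
        qed (use A in auto)
        finally show ?thesis .
      qed
    qed
    then show "glue A (S, g, h) \<in> parking_maps A u" by (simp add: f_def)
  qed
qed

lemma card_parking_maps_split:
  assumes A: "finite A" and u: "\<And>i. i \<in> {1..card A} \<Longrightarrow> i \<le> u i"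
  shows "card (parking_maps A u) =
    (\<Sum>S\<in>Pow A. card (parking_maps S id) * card (parking_maps (A - S) (shift (card S) u)))"
proof -
  have "card (parking_maps A u) =
      card (SIGMA S:Pow A. parking_maps S id \<times> parking_maps (A - S) (shift (card S) u))"
    using bij_betw_same_card[OF bij_betw_cut[OF A u]] by simp
  also have "\<dots> = (\<Sum>S\<in>Pow A. card (parking_maps S id \<times> parking_maps (A - S) (shift (card S) u)))"
    using A by (intro card_SigmaI) (auto intro!: finite_parking_maps intro: finite_subset)
  finally show ?thesis by (simp add: card_cartesian_product)
qed

section \<open>Counting classical parking maps\<close>

lemma sum_Pow_card:
  fixes F :: "nat \<Rightarrow> real"
  assumes "finite A"
  shows "(\<Sum>S\<in>Pow A. F (card S)) = (\<Sum>k\<le>card A. real (card A choose k) * F k)"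
proof -
  have "(\<Sum>S\<in>Pow A. F (card S)) = (\<Sum>k\<le>card A. \<Sum>S\<in>{S\<in>Pow A. card S = k}. F (card S))"
    using assms by (intro sum.group[symmetric]) (auto intro: card_mono)
  also have "\<dots> = (\<Sum>k\<le>card A. real (card A choose k) * F k)"
    using n_subsets[OF assms] by (intro sum.cong) (auto simp: Pow_def)
  finally show ?thesis .
qed

text \<open>Split the \<open>(m + 1) ^ m\<close> maps into \<open>{1..m + 1}\<close> at the first empty spot. The term for
\<open>S = A\<close> is the number sought, and all others are known by induction. Abel's identity at
\<open>x = m + 1\<close> has the same terms for the proper subsets, hence also the same term for \<open>A\<close>.\<close>

lemma card_classical_parking_maps:
  assumes "finite A"
  shows "real (card (parking_maps A id)) = (real (card A) + 1) ^ (card A - 1)"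
  using assms
proof (induction "card A" arbitrary: A rule: less_induct)
  case less
  define m where "m = card A"
  define P where "P k = (real k + 1) ^ (k - 1) * real (m - k) ^ (m - k)" for k
  have summand: "real (card (parking_maps S id)
        * card (parking_maps (A - S) (shift (card S) (\<lambda>_. Suc m)))) = P (card S)"
    if "S \<subset> A" for S
  proof -
    have lt: "card S < card A" using that less.prems by (rule psubset_card_mono[rotated])
    have fin: "finite S" using that less.prems finite_subset by blast
    have "shift (card S) (\<lambda>_. Suc m) = (\<lambda>_. m - card S)" by (auto simp: shift_def)
    moreover have "card (A - S) = m - card S"
      unfolding m_def using that fin by (intro card_Diff_subset) auto
    ultimately show ?thesis
      using less.hyps[OF lt fin] less.prems by (simp add: card_parking_maps_const P_def)
  qed
  have "real (Suc m ^ m) = real (card (parking_maps A (\<lambda>_. Suc m)))"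
    using less.prems by (simp add: card_parking_maps_const m_def)
  also have "\<dots> = (\<Sum>S\<in>Pow A. real (card (parking_maps S id)
        * card (parking_maps (A - S) (shift (card S) (\<lambda>_. Suc m)))))"
    by (subst card_parking_maps_split) (use less.prems m_def in auto)
  also have "\<dots> = real (card (parking_maps A id) * card (parking_maps ({} :: 'a set) (shift m (\<lambda>_. Suc m))))
      + (\<Sum>S\<in>Pow A - {A}. P (card S))"
  proof -
    have "(\<Sum>S\<in>Pow A - {A}. real (card (parking_maps S id)
        * card (parking_maps (A - S) (shift (card S) (\<lambda>_. Suc m))))) = (\<Sum>S\<in>Pow A - {A}. P (card S))"
      by (rule sum.cong[OF refl], rule summand) auto
    then show ?thesis
      by (subst sum.remove[of _ A]) (use less.prems m_def in simp_all)
  qed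
  also have "card (parking_maps ({} :: 'a set) (shift m (\<lambda>_. Suc m))) = 1"
    by (simp add: parking_maps_def)
  also have "(\<Sum>S\<in>Pow A - {A}. P (card S)) = (\<Sum>S\<in>Pow A. P (card S)) - P m"
    using less.prems by (subst sum_diff1) (auto simp: m_def)
  also have "(\<Sum>S\<in>Pow A. P (card S)) = (\<Sum>k\<le>m. real (m choose k) * P k)"
    using sum_Pow_card[OF less.prems] m_def by simp
  also have "\<dots> = real (Suc m) ^ m"
    unfolding Abel_identity_special[of "real (Suc m)" m]
    by (intro sum.cong) (auto simp: P_def of_nat_diff)
  finally show ?case by (simp add: P_def m_def id_def)
qed

section \<open>Summing over the block sizes\<close>

text \<open>The set \<open>C(m)\<close> with the number \<open>L\<close> of blocks and the number \<open>m\<close> of cars as independent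
parameters: after the first block is split off, \<open>u\<^sub>m - m + 1 = L\<close> makes no sense when no cars
are left, although \<open>L\<close> may still be positive. Writing \<open>Suc (u i) - i\<close> instead of
\<open>u i - i + 1\<close> gives the intended value \<open>0\<close> when \<open>u i = i - 1\<close>, which occurs for shifted
vectors.\<close>

definition gap_vectors :: "nat \<Rightarrow> nat \<Rightarrow> (nat \<Rightarrow> nat) \<Rightarrow> nat list set" where
  "gap_vectors L m u = {s. length s = L \<and> sum_list s = m \<and>
     (\<forall>i\<in>{1..m}. i \<le> sum_list (take (Suc (u i) - i) s))}"

definition block_weight :: "nat \<Rightarrow> real" where
  "block_weight k = (real k + 1) ^ (k - 1) / fact k"

lemma finite_gap_vectors: "finite (gap_vectors L m u)"
proof (rule finite_subset)
  show "gap_vectors L m u \<subseteq> {s. set s \<subseteq> {..m} \<and> length s = L}"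
    by (auto simp: gap_vectors_def member_le_sum_list)
qed (simp add: finite_lists_length_eq)

text \<open>The condition for \<open>i\<close> up to the first block size \<open>k\<close> is met by that block alone, which is
among the blocks counted because \<open>i \<le> u i\<close>. For
\<open>i > k\<close> it turns into the condition for \<open>i - k\<close> on the tail, since shifting the vector
replaces the number \<open>u i - i + 1\<close> of blocks by \<open>u i - i\<close>.\<close>

lemma gap_vectors_Suc:
  assumes u: "\<And>i. i \<in> {1..m} \<Longrightarrow> i \<le> u i"
  shows "gap_vectors (Suc L) m u =
    (\<lambda>(k, t). k # t) ` (SIGMA k:{..m}. gap_vectors L (m - k) (shift k u))"
proof -
  have iff: "k # t \<in> gap_vectors (Suc L) m u \<longleftrightarrow> k \<le> m \<and> t \<in> gap_vectors L (m - k) (shift k u)" for k t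
  proof -
    have take: "sum_list (take (Suc (u i) - i) (k # t)) = k + sum_list (take (u i - i) t)" if "i \<in> {1..m}" for i
      using u[OF that] by (simp add: Suc_diff_le)
    have shifted: "Suc (shift k u i) - i = u (i + k) - (i + k)" if "i \<in> {1..m - k}" for i
      using u[of "i + k"] that by (auto simp: shift_def)
    have "(\<forall>i\<in>{1..m}. i \<le> k + sum_list (take (u i - i) t)) \<longleftrightarrow>
        (\<forall>i\<in>{1..m - k}. i \<le> sum_list (take (Suc (shift k u i) - i) t))" (is "?L \<longleftrightarrow> ?R")
    proof
      assume L: ?L
      show ?R
      proof
        fix i assume i: "i \<in> {1..m - k}"
        then have "i + k \<in> {1..m}" by auto
        then have "i + k \<le> k + sum_list (take (u (i + k) - (i + k)) t)" using L by blast
        then show "i \<le> sum_list (take (Suc (shift k u i) - i) t)" using shifted[OF i] by simp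
      qed
    next
      assume R: ?R
      show ?L
      proof
        fix i assume i: "i \<in> {1..m}"
        show "i \<le> k + sum_list (take (u i - i) t)"
        proof (cases "i \<le> k")
          case False
          then have l: "i - k \<in> {1..m - k}" using i by auto
          then have "i - k \<le> sum_list (take (Suc (shift k u (i - k)) - (i - k)) t)" using R by blast
          then show ?thesis using shifted[OF l] False by simp
        qed simp
      qed
    qed
    then show ?thesis using take by (auto simp: gap_vectors_def)
  qed
  show ?thesis
  proof (intro equalityI subsetI)
    fix s assume s: "s \<in> gap_vectors (Suc L) m u"
    then obtain k t where "s = k # t" by (cases s) (auto simp: gap_vectors_def)
    then show "s \<in> (\<lambda>(k, t). k # t) ` (SIGMA k:{..m}. gap_vectors L (m - k) (shift k u))"
      using s iff by (intro image_eqI[of _ _ "(k, t)"]) auto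
  qed (use iff in auto)
qed

lemma strict_mono_id_le:
  fixes u :: "nat \<Rightarrow> nat"
  assumes "\<And>i. 1 \<le> i \<Longrightarrow> i < m \<Longrightarrow> u i < u (Suc i)" and "1 \<le> u 1" and "i \<in> {1..m}"
  shows "i \<le> u i"
  using assms(3)
proof (induction i)
  case (Suc i)
  then show ?case using assms(1)[of i] assms(2) by (cases "i = 0") auto
qed simp

text \<open>Dividing by \<open>m!\<close> turns the binomial recursion into a convolution, so that each
block contributes a factor of its own. The hypothesis \<open>u i < L + i\<close> (rather than an equality
for \<open>i = m\<close>) survives the passage to a smaller number of cars. The case \<open>u 1 = 0\<close>, in which
both sides vanish, cannot be excluded: it arises when the shifted vector leaves no room for the
next car.\<close>

lemma card_parking_maps_eq_gap_sum:
  assumes "finite A" and "\<And>i. 1 \<le> i \<Longrightarrow> i < card A \<Longrightarrow> u i < u (Suc i)"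
    and "\<And>i. i \<in> {1..card A} \<Longrightarrow> u i < L + i"
  shows "real (card (parking_maps A u)) / fact (card A) =
    (\<Sum>s\<in>gap_vectors L (card A) u. prod_list (map block_weight s))"
  using assms
proof (induction L arbitrary: A u)
  case base: 0
  show ?case
  proof (cases "A = {}")
    case True
    moreover have "gap_vectors 0 0 u = {[]}" by (auto simp: gap_vectors_def)
    ultimately show ?thesis by (simp add: parking_maps_def)
  next
    case False
    then have c: "1 \<in> {1..card A}" using base.prems(1) by (auto simp: Suc_le_eq card_gt_0_iff)
    then have u1: "u 1 = 0" using base.prems(3)[OF c] by simp
    have "parking_maps A u = {}" using c u1 by (intro parking_maps_empty) auto
    moreover have "gap_vectors 0 (card A) u = {}" using c by (auto simp: gap_vectors_def)
    ultimately show ?thesis by simp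
  qed
next
  case (Suc L)
  define m where "m = card A"
  show ?case
  proof (cases "m \<ge> 1 \<and> u 1 = 0")
    case True
    then have c: "1 \<in> {1..card A}" by (simp add: m_def)
    have "parking_maps A u = {}" using c True by (intro parking_maps_empty) auto
    moreover have "gap_vectors (Suc L) (card A) u = {}"
      using c True by (force simp: gap_vectors_def)
    ultimately show ?thesis by simp
  next
    case False
    have u: "i \<le> u i" if "i \<in> {1..m}" for i
      using that False Suc.prems(2) by (intro strict_mono_id_le[of m u i]) (auto simp: m_def)
    define Q where "Q k = (\<Sum>t\<in>gap_vectors L (m - k) (shift k u). prod_list (map block_weight t))" for k
    have rest: "real (card (parking_maps (A - S) (shift (card S) u))) = fact (m - card S) * Q (card S)"
      if S: "S \<subseteq> A" for S
    proof -
      have fin: "finite S" using S Suc.prems(1) finite_subset by blast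
      have c: "card (A - S) = m - card S" using card_Diff_subset[OF fin S] m_def by simp
      have "real (card (parking_maps (A - S) (shift (card S) u))) / fact (card (A - S)) = Q (card S)"
        unfolding Q_def c[symmetric]
      proof (rule Suc.IH)
        fix i assume i: "1 \<le> i" "i < card (A - S)"
        then have "u (i + card S) < u (Suc (i + card S))" using Suc.prems(2) c m_def by simp
        moreover have "i + card S \<le> u (i + card S)" using u i c by simp
        ultimately show "shift (card S) u i < shift (card S) u (Suc i)"
          using i by (simp add: shift_def)
      next
        fix i assume i: "i \<in> {1..card (A - S)}"
        then have "u (i + card S) < Suc L + (i + card S)" using Suc.prems(3) c m_def by auto
        then show "shift (card S) u i < L + i" using i by (auto simp: shift_def)
      qed (use Suc.prems in auto)
      then show ?thesis using c by (simp add: field_simps)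
    qed
    have "real (card (parking_maps A u)) =
        (\<Sum>S\<in>Pow A. (real (card S) + 1) ^ (card S - 1) * (fact (m - card S) * Q (card S)))"
    proof -
      have "card (parking_maps A u) =
          (\<Sum>S\<in>Pow A. card (parking_maps S id) * card (parking_maps (A - S) (shift (card S) u)))"
        using Suc.prems(1) u by (intro card_parking_maps_split) (auto simp: m_def)
      then have "real (card (parking_maps A u)) =
          (\<Sum>S\<in>Pow A. real (card (parking_maps S id)) * real (card (parking_maps (A - S) (shift (card S) u))))"
        by simp
      moreover have "real (card (parking_maps S id)) = (real (card S) + 1) ^ (card S - 1)" if "S \<subseteq> A" for S
        using that Suc.prems(1) by (intro card_classical_parking_maps) (rule finite_subset)
      ultimately show ?thesis
        unfolding of_nat_sum of_nat_mult using rest by (auto intro!: sum.cong)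
    qed
    also have "\<dots> = (\<Sum>k\<le>m. real (m choose k) * ((real k + 1) ^ (k - 1) * (fact (m - k) * Q k)))"
      using sum_Pow_card[OF Suc.prems(1), of "\<lambda>k. (real k + 1) ^ (k - 1) * (fact (m - k) * Q k)"]
      by (simp add: m_def)
    also have "\<dots> = (\<Sum>k\<le>m. fact m * (block_weight k * Q k))"
      by (intro sum.cong) (auto simp: binomial_fact block_weight_def)
    finally have "real (card (parking_maps A u)) / fact m = (\<Sum>k\<le>m. block_weight k * Q k)"
      by (simp add: sum_distrib_left[symmetric])
    also have "\<dots> = (\<Sum>s\<in>gap_vectors (Suc L) m u. prod_list (map block_weight s))"
    proof -
      have split: "gap_vectors (Suc L) m u =
          (\<lambda>(k, t). k # t) ` (SIGMA k:{..m}. gap_vectors L (m - k) (shift k u))"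
        using u by (rule gap_vectors_Suc)
      have inj: "inj_on (\<lambda>(k, t). k # t) (SIGMA k:{..m}. gap_vectors L (m - k) (shift k u))"
        by (auto simp: inj_on_def)
      show ?thesis
        unfolding split sum.reindex[OF inj] Q_def sum_distrib_left
        by (subst sum.Sigma) (auto simp: finite_gap_vectors intro!: sum.cong)
    qed
    finally show ?thesis by (simp add: m_def)
  qed
qed

section \<open>Translation to lists\<close>

lemma sorted_nth_le_iff_card:
  assumes "sorted xs" "i < length xs"
  shows "xs ! i \<le> b \<longleftrightarrow> Suc i \<le> card {j. j < length xs \<and> xs ! j \<le> b}"
proof
  assume "xs ! i \<le> b"
  then have "{..i} \<subseteq> {j. j < length xs \<and> xs ! j \<le> b}"
    using assms by (auto intro: order_trans[OF sorted_nth_mono])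
  then have "card {..i} \<le> card {j. j < length xs \<and> xs ! j \<le> b}" by (intro card_mono) auto
  then show "Suc i \<le> card {j. j < length xs \<and> xs ! j \<le> b}" by simp
next
  assume c: "Suc i \<le> card {j. j < length xs \<and> xs ! j \<le> b}"
  show "xs ! i \<le> b"
  proof (rule ccontr)
    assume "\<not> xs ! i \<le> b"
    moreover have "xs ! i \<le> xs ! j" if "i \<le> j" "j < length xs" for j
      using assms(1) that by (rule sorted_nth_mono)
    ultimately have "j < i" if "j < length xs" "xs ! j \<le> b" for j
      using that order_trans not_le by blast
    then have "{j. j < length xs \<and> xs ! j \<le> b} \<subseteq> {..<i}" by auto
    then have "card {j. j < length xs \<and> xs ! j \<le> b} \<le> card {..<i}" by (intro card_mono) auto
    then show False using c by simp
  qed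
qed

lemma sort_nth_le_iff_card:
  assumes "i < length p"
  shows "sort p ! i \<le> b \<longleftrightarrow> Suc i \<le> card {j. j < length p \<and> p ! j \<le> b}"
proof -
  have "card {j. j < length p \<and> sort p ! j \<le> b} = length (filter (\<lambda>x. x \<le> b) (sort p))"
    by (simp add: length_filter_conv_card)
  also have "\<dots> = length (filter (\<lambda>x. x \<le> b) p)"
    by (simp add: filter_sort)
  also have "\<dots> = card {j. j < length p \<and> p ! j \<le> b}"
    by (simp add: length_filter_conv_card)
  finally show ?thesis using sorted_nth_le_iff_card[of "sort p" i b] assms by simp
qed

lemma card_PF:
  "card (PF u) = card (parking_maps {..<length u} (\<lambda>i. u ! (i - 1)))"
proof (rule bij_betw_same_card)
  let ?m = "length u"
  have set_eq: "{j\<in>{..<?m}. restrict ((!) p) {..<?m} j \<le> b} = {j. j < ?m \<and> p ! j \<le> b}" for p b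
    by auto
  have PF_iff: "p \<in> PF u \<longleftrightarrow> restrict ((!) p) {..<?m} \<in> parking_maps {..<?m} (\<lambda>i. u ! (i - 1))"
    if "length p = ?m" for p
  proof -
    have "(\<forall>x\<in>set p. 1 \<le> x) \<longleftrightarrow> restrict ((!) p) {..<?m} \<in> {..<?m} \<rightarrow>\<^sub>E {1..}"
      using that by (auto simp: PiE_iff all_set_conv_all_nth)
    moreover have "sort p ! (i - 1) \<le> u ! (i - 1) \<longleftrightarrow> i \<le> card {j. j < ?m \<and> p ! j \<le> u ! (i - 1)}"
      if i: "i \<in> {1..?m}" for i
      using sort_nth_le_iff_card[of "i - 1" p "u ! (i - 1)"] i \<open>length p = ?m\<close> by auto
    ultimately show ?thesis
      using that unfolding PF_def parking_maps_def mem_Collect_eq set_eq by simp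
  qed
  have map_upt: "restrict ((!) (map f [0..<?m])) {..<?m} = f" if "f \<in> extensional {..<?m}" for f :: "nat \<Rightarrow> nat"
    using that by (auto simp: fun_eq_iff extensional_def)
  show "bij_betw (\<lambda>p. restrict ((!) p) {..<?m}) (PF u) (parking_maps {..<?m} (\<lambda>i. u ! (i - 1)))"
  proof (rule bij_betw_byWitness[where f' = "\<lambda>f. map f [0..<?m]"])
    show "\<forall>p\<in>PF u. map (restrict ((!) p) {..<?m}) [0..<?m] = p"
      by (auto simp: PF_def intro: nth_equalityI)
    show "\<forall>f\<in>parking_maps {..<?m} (\<lambda>i. u ! (i - 1)). restrict ((!) (map f [0..<?m])) {..<?m} = f"
      using map_upt by (auto simp: parking_maps_def PiE_iff)
    show "(\<lambda>p. restrict ((!) p) {..<?m}) ` PF u \<subseteq> parking_maps {..<?m} (\<lambda>i. u ! (i - 1))"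
      using PF_iff by (auto simp: PF_def)
    show "(\<lambda>f. map f [0..<?m]) ` parking_maps {..<?m} (\<lambda>i. u ! (i - 1)) \<subseteq> PF u"
    proof clarify
      fix f assume f: "f \<in> parking_maps {..<?m} (\<lambda>i. u ! (i - 1))"
      then have "f \<in> extensional {..<?m}" by (auto simp: parking_maps_def PiE_iff)
      then show "map f [0..<?m] \<in> PF u" using f map_upt PF_iff[of "map f [0..<?m]"] by simp
    qed
  qed
qed

lemma sum_nth_eq_sum_list_take:
  fixes s :: "nat list"
  assumes "n \<le> length s"
  shows "(\<Sum>j=1..n. s ! (j - 1)) = sum_list (take n s)"
proof -
  have "(\<Sum>j=1..n. s ! (j - 1)) = (\<Sum>j<n. s ! j)"
    by (rule sum.reindex_bij_witness[of _ Suc "\<lambda>j. j - 1"]) auto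
  then show ?thesis using assms by (simp add: sum_list_sum_nth atLeast0LessThan)
qed

lemma prod_nth_eq_prod_list:
  "(\<Prod>j=1..length s. w (s ! (j - 1))) = prod_list (map w s)"
proof -
  have "(\<Prod>j=1..length s. w (s ! (j - 1))) = (\<Prod>j<length s. w (s ! j))"
    by (rule prod.reindex_bij_witness[of _ Suc "\<lambda>j. j - 1"]) auto
  also have "\<dots> = prod_list (map w s)"
    by (induction s) (simp_all add: prod.lessThan_Suc_shift del: prod.lessThan_Suc)
  finally show ?thesis .
qed

theorem proposition2p8:
  fixes m :: nat and u :: "nat list"
  assumes "m \<ge> 1"
    and "length u = m"
    and "\<forall>x\<in>set u. x \<ge> 1"
    and "sorted_wrt (<) u"
  shows "real (card (PF u)) =
    (\<Sum>s\<in>C u. multinomial m s *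
      (\<Prod>i=1..u ! (m - 1) - m + 1. (real (s ! (i - 1)) + 1) powi (int (s ! (i - 1)) - 1)))"
proof -
  define v where "v i = u ! (i - 1)" for i
  define L where "L = v m - m + 1"
  have incr: "v i < v (Suc i)" if "1 \<le> i" "i < m" for i
    using that assms(2,4) unfolding v_def by (auto intro: sorted_wrt_nth_less)
  have "1 \<le> v 1" using assms(1-3) unfolding v_def by auto
  then have ge: "i \<le> v i" if "i \<in> {1..m}" for i
    using that incr by (intro strict_mono_id_le[of m v i]) auto
  \<comment> \<open>This bounds every \<open>v i\<close> from above by \<open>v m - (m - i)\<close>, so the sums defining
      \<open>C u\<close> stay within the \<open>L\<close> entries of \<open>s\<close>.\<close>
  have spread: "v i + d \<le> v (i + d)" if "1 \<le> i" "i + d \<le> m" for i d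
    using that(2)
  proof (induction d)
    case (Suc d)
    then show ?case using incr[of "i + d"] that(1) by simp
  qed simp
  have upper: "v i < L + i" if "i \<in> {1..m}" for i
    using spread[of i "m - i"] that ge[of m] by (auto simp: L_def)
  have C: "C u = gap_vectors L m v"
  proof -
    have "(\<Sum>j=1..v i - i + 1. s ! (j - 1)) = sum_list (take (Suc (v i) - i) s)"
      if "i \<in> {1..m}" "length s = L" for i and s :: "nat list"
      using that upper[of i] ge[of i] by (subst sum_nth_eq_sum_list_take) (auto simp: Suc_diff_le)
    moreover have "(\<Sum>j=1..L. s ! (j - 1)) = sum_list s" if "length s = L" for s :: "nat list"
      using sum_nth_eq_sum_list_take[of L s] that by simp
    ultimately show ?thesis
      unfolding C_def Let_def assms(2) gap_vectors_def v_def[symmetric] L_def[symmetric] by auto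
  qed
  have weight: "multinomial m s *
      (\<Prod>i=1..L. (real (s ! (i - 1)) + 1) powi (int (s ! (i - 1)) - 1))
      = fact m * prod_list (map block_weight s)" if "s \<in> gap_vectors L m v" for s
  proof -
    \<comment> \<open>At \<open>k = 0\<close> the exponent \<open>-1\<close> becomes the truncated \<open>0\<close>, but the base is \<open>1\<close>.\<close>
    have powi: "(real k + 1) powi (int k - 1) = (real k + 1) ^ (k - 1)" for k
      by (cases k) (simp_all add: power_int_def)
    have "length s = L" using that by (simp add: gap_vectors_def)
    then show ?thesis
      unfolding multinomial_def powi prod_nth_eq_prod_list[symmetric] block_weight_def
      by (simp add: prod_dividef)
  qed
  have "real (card (PF u)) / fact m = (\<Sum>s\<in>gap_vectors L m v. prod_list (map block_weight s))"
    using card_parking_maps_eq_gap_sum[of "{..<m}" v L] incr upper assms(2)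
    by (simp add: card_PF v_def[abs_def])
  then have "real (card (PF u)) = (\<Sum>s\<in>gap_vectors L m v. fact m * prod_list (map block_weight s))"
    by (simp add: sum_distrib_left[symmetric] field_simps)
  also have "\<dots> = (\<Sum>s\<in>C u. multinomial m s *
      (\<Prod>i=1..L. (real (s ! (i - 1)) + 1) powi (int (s ! (i - 1)) - 1)))"
    unfolding C using weight by (intro sum.cong) auto
  finally show ?thesis unfolding L_def v_def .
qed

end
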